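(* For every integer $k \geq 1$, the polynomial $2A_{k}(x,x,\ldots,x)$ (all $2k$ variables set equal to $x$) is equal to the $2k$-th Lucas polynomial $L_{2k}(x)$.
   Context: Let $\sigma_{1} = \begin{pmatrix} 0 & 1 \\ 1 & 0 \end{pmatrix}$, $\sigma_{2} = \begin{pmatrix} 0 & -\sqrt{-1} \\ \sqrt{-1} & 0 \end{pmatrix}$, $\sigma_{3} = \begin{pmatrix} 1 & 0 \\ 0 & -1 \end{pmatrix}$ be the Pauli matrices; together with the identity $I$ they form a basis of the complex $2\times 2$ matrices. Put $M(x,y) = \begin{pmatrix} 1+xy & x \\ y & 1 \end{pmatrix}$ and, for $k\ge 1$, $M(x_{1},y_{1},\ldots,x_{k},y_{k}) = M(x_{1},y_{1})\cdots M(x_{k},y_{k})$. The polynomials $A_k,B_k,C_k,D_k$ in $x_1,y_1,\ldots,x_k,y_k$ (with complex coefficients) are defined by $$M(x_{1},y_{1},\ldots,x_{k},y_{k}) = A_{k} I + B_{k} \sigma_{1} + C_{k} \sigma_{2} + D_{k} \sigma_{3}.$$ The Lucas polynomials are defined by $L_{0}(x)=2$, $L_{1}(x)=x$ and $L_{k+1}(x) = xL_{k}(x)+L_{k-1}(x)$ for $k\ge 1$. *)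

theory Defs
  imports "HOL-Analysis.Analysis" "HOL-Library.Poly_Mapping"
    "HOL-Computational_Algebra.Polynomial"
begin

datatype var = X nat | Y nat

text \<open>
  Polynomials with complex coefficients in the variables \<open>X 1, Y 1, X 2, Y 2, \<dots>\<close>: a polynomial is
  a finitely supported map from monomials, that is finitely supported exponent functions, to
  coefficients. The product of poly mappings is convolution, so this type is the polynomial ring
  in all of these variables; the ring in the first \<open>2 * k\<close> of them is a subring.
\<close>
type_synonym mpoly = "(var \<Rightarrow>\<^sub>0 nat) \<Rightarrow>\<^sub>0 complex"

definition mconst :: "complex \<Rightarrow> mpoly" where
  "mconst c = Poly_Mapping.single 0 c"

definition mvar :: "var \<Rightarrow> mpoly" where
  "mvar v = Poly_Mapping.single (Poly_Mapping.single v 1) 1"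

definition subst :: "(var \<Rightarrow> complex poly) \<Rightarrow> mpoly \<Rightarrow> complex poly" where
  "subst f p = (\<Sum>m\<in>Poly_Mapping.keys p.
     [:Poly_Mapping.lookup p m:] * (\<Prod>v\<in>Poly_Mapping.keys m. f v ^ Poly_Mapping.lookup m v))"

definition sigma1 :: "complex^2^2" where
  "sigma1 = vector [vector [0, 1], vector [1, 0]]"

definition sigma2 :: "complex^2^2" where
  "sigma2 = vector [vector [0, - \<i>], vector [\<i>, 0]]"

definition sigma3 :: "complex^2^2" where
  "sigma3 = vector [vector [1, 0], vector [0, - 1]]"

definition scale_mat :: "mpoly \<Rightarrow> complex^2^2 \<Rightarrow> mpoly^2^2" where
  "scale_mat a N = (\<chi> i j. a * mconst (N $ i $ j))"

definition M :: "mpoly \<Rightarrow> mpoly \<Rightarrow> mpoly^2^2" where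
  "M x y = vector [vector [1 + x * y, x], vector [y, 1]]"

primrec M_prod :: "nat \<Rightarrow> mpoly^2^2" where
  "M_prod 0 = mat 1"
| "M_prod (Suc k) = M_prod k ** M (mvar (X (Suc k))) (mvar (Y (Suc k)))"

definition is_pauli_expansion :: "mpoly^2^2 \<Rightarrow> mpoly \<times> mpoly \<times> mpoly \<times> mpoly \<Rightarrow> bool" where
  "is_pauli_expansion N = (\<lambda>(a, b, c, d).
     N = scale_mat a (mat 1) + scale_mat b sigma1 + scale_mat c sigma2 + scale_mat d sigma3)"

lemma mconst_simps:
  "mconst 0 = 0" "mconst 1 = 1" "mconst (- z) = - mconst z"
  "mconst (z + w) = mconst z + mconst w" "mconst (z * w) = mconst z * mconst w"
  by (simp_all add: mconst_def single_one single_uminus single_add mult_single)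

lemma is_pauli_expansion_iff:
  "is_pauli_expansion N (a, b, c, d) \<longleftrightarrow>
     N $ 1 $ 1 = a + d \<and> N $ 1 $ 2 = b - mconst \<i> * c \<and>
     N $ 2 $ 1 = b + mconst \<i> * c \<and> N $ 2 $ 2 = a - d"
  by (auto simp: is_pauli_expansion_def scale_mat_def vec_eq_iff forall_2 mat_def
      sigma1_def sigma2_def sigma3_def mconst_simps mult.commute)

lemma ex1_pauli_expansion: "\<exists>!q. is_pauli_expansion N q"
proof -
  define h where "h = mconst (1/2)"
  define i where "i = mconst \<i>"
  have h: "h + h = 1"
    by (simp add: h_def mconst_simps(2) flip: mconst_simps(4))
  have i: "i * i = - 1"
    by (simp add: i_def mconst_simps(2,3) flip: mconst_simps(5))
  have double: "h * x + h * x = x" for x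
    by (simp add: h flip: distrib_right)
  have split: "h * (u + v) + h * (u - v) = u" "h * (u + v) - h * (u - v) = v" for u v :: mpoly
    using double[of u] double[of v] by (simp_all add: algebra_simps)
  have ii: "i * (i * x) = - x" for x
    by (simp add: i flip: mult.assoc)
  show ?thesis
  proof (rule ex1I)
    let ?q = "(h * (N$1$1 + N$2$2), h * (N$2$1 + N$1$2), - i * (h * (N$2$1 - N$1$2)),
               h * (N$1$1 - N$2$2))"
    show "is_pauli_expansion N ?q"
      unfolding is_pauli_expansion_iff i_def[symmetric] by (simp add: ii split)
    fix q assume q: "is_pauli_expansion N q"
    obtain a b c d where q_eq: "q = (a, b, c, d)" by (cases q)
    have e: "N$1$1 = a + d" "N$1$2 = b - i * c" "N$2$1 = b + i * c" "N$2$2 = a - d"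
      using q unfolding q_eq is_pauli_expansion_iff i_def by auto
    show "q = ?q"
      unfolding q_eq prod.inject e using double[of a] double[of b] double[of c] double[of d]
      by (simp add: algebra_simps ii)
  qed
qed

definition A_poly :: "nat \<Rightarrow> mpoly" where
  "A_poly k = fst (THE q. is_pauli_expansion (M_prod k) q)"

fun lucas_poly :: "nat \<Rightarrow> complex poly" where
  "lucas_poly 0 = 2"
| "lucas_poly (Suc 0) = [:0, 1:]"
| "lucas_poly (Suc (Suc k)) = [:0, 1:] * lucas_poly (Suc k) + lucas_poly k"

end

theory Submission
  imports Defs
begin

text \<open>The Pauli matrices are traceless, so \<open>2 * A_poly k\<close> is the trace of
  \<open>M_prod k\<close> (\<open>double_A_poly\<close>). Substitution is a ring homomorphism
  (\<open>subst_add\<close>, \<open>subst_mult\<close>, \<open>subst_one\<close>), so the trace may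
  be computed after setting all variables to x. There each factor becomes T^2 with T = [[x, 1],
  [1, 0]]. Since T^2 = x T + I, the traces of the powers of T satisfy the Lucas recurrence, starting
  from 2 and x. \<open>subst_M_prod_lucas\<close> realises this by induction on the matrix
  entries.\<close>

definition monomial_value :: "(var \<Rightarrow> complex poly) \<Rightarrow> (var \<Rightarrow>\<^sub>0 nat) \<Rightarrow> complex poly" where
  "monomial_value f m = (\<Prod>v\<in>Poly_Mapping.keys m. f v ^ Poly_Mapping.lookup m v)"

lemma monomial_value_superset:
  assumes "finite S" "Poly_Mapping.keys m \<subseteq> S"
  shows "monomial_value f m = (\<Prod>v\<in>S. f v ^ Poly_Mapping.lookup m v)"
  unfolding monomial_value_def
  by (rule prod.mono_neutral_left) (use assms in \<open>auto simp: in_keys_iff\<close>)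

lemma monomial_value_add: "monomial_value f (m + n) = monomial_value f m * monomial_value f n"
proof -
  let ?S = "Poly_Mapping.keys m \<union> Poly_Mapping.keys n"
  have "monomial_value f (m + n) = (\<Prod>v\<in>?S. f v ^ Poly_Mapping.lookup (m + n) v)"
    by (rule monomial_value_superset) (auto dest: subsetD[OF keys_add])
  also have "\<dots> = (\<Prod>v\<in>?S. f v ^ Poly_Mapping.lookup m v) * (\<Prod>v\<in>?S. f v ^ Poly_Mapping.lookup n v)"
    by (simp add: lookup_add power_add prod.distrib)
  also have "\<dots> = monomial_value f m * monomial_value f n"
    by (simp add: monomial_value_superset[of ?S])
  finally show ?thesis .
qed

text \<open>Monomials outside the support have coefficient 0. Summing over a common finite set makes
  polynomials with different supports comparable, as additivity requires.\<close>

lemma subst_superset: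
  assumes "finite S" "Poly_Mapping.keys p \<subseteq> S"
  shows "subst f p = (\<Sum>m\<in>S. [:Poly_Mapping.lookup p m:] * monomial_value f m)"
  unfolding subst_def monomial_value_def[symmetric]
  by (rule sum.mono_neutral_left) (use assms in \<open>auto simp: in_keys_iff\<close>)

lemma subst_add: "subst f (p + q) = subst f p + subst f q"
proof -
  let ?S = "Poly_Mapping.keys p \<union> Poly_Mapping.keys q"
  have "subst f (p + q) = (\<Sum>m\<in>?S. [:Poly_Mapping.lookup (p + q) m:] * monomial_value f m)"
    by (rule subst_superset) (auto dest: subsetD[OF keys_add])
  also have "\<dots> = (\<Sum>m\<in>?S. [:Poly_Mapping.lookup p m:] * monomial_value f m)
      + (\<Sum>m\<in>?S. [:Poly_Mapping.lookup q m:] * monomial_value f m)"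
    by (simp add: lookup_add smult_add_left sum.distrib)
  also have "\<dots> = subst f p + subst f q"
    by (simp only: subst_superset[of ?S] finite_Un finite_keys Un_upper1 Un_upper2 simp_thms)
  finally show ?thesis .
qed

lemma subst_zero: "subst f 0 = 0"
  by (simp add: subst_def)

lemma subst_sum: "subst f (sum g I) = (\<Sum>i\<in>I. subst f (g i))"
  by (induction I rule: infinite_finite_induct) (simp_all add: subst_zero subst_add)

lemma subst_single: "subst f (Poly_Mapping.single m c) = [:c:] * monomial_value f m"
  using subst_superset[of "{m}" "Poly_Mapping.single m c" f] by simp

lemma mpoly_eq_sum_single:
  "p = (\<Sum>m\<in>Poly_Mapping.keys p. Poly_Mapping.single m (Poly_Mapping.lookup p m))"
  by (rule poly_mapping_eqI)
    (simp add: lookup_sum lookup_single when_def in_keys_iff sum.delta)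

text \<open>By bilinearity it suffices to treat single terms, where exponents add and
  \<open>monomial_value_add\<close> applies.\<close>

lemma subst_mult: "subst f (p * q) = subst f p * subst f q"
proof -
  let ?s = "\<lambda>r m. Poly_Mapping.single m (Poly_Mapping.lookup r m)"
  have "subst f (p * q)
      = subst f ((\<Sum>m\<in>Poly_Mapping.keys p. ?s p m) * (\<Sum>n\<in>Poly_Mapping.keys q. ?s q n))"
    by (simp flip: mpoly_eq_sum_single)
  also have "\<dots> = (\<Sum>m\<in>Poly_Mapping.keys p. \<Sum>n\<in>Poly_Mapping.keys q.
      subst f (?s p m) * subst f (?s q n))"
    by (simp add: sum_product subst_sum mult_single subst_single monomial_value_add mult_ac)
  also have "\<dots> = subst f (\<Sum>m\<in>Poly_Mapping.keys p. ?s p m)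
      * subst f (\<Sum>n\<in>Poly_Mapping.keys q. ?s q n)"
    by (simp only: sum_product subst_sum)
  finally show ?thesis
    by (simp flip: mpoly_eq_sum_single)
qed

lemma subst_one: "subst f 1 = 1"
  using subst_single[of f 0 1] by (simp add: monomial_value_def one_pCons)

lemma subst_mvar: "subst f (mvar v) = f v"
  by (simp add: mvar_def subst_single monomial_value_def)

text \<open>The diagonal entries are a + d and a - d, so d cancels in the trace. Unique existence of
  the expansion gives \<open>THE\<close> its meaning.\<close>

lemma double_A_poly: "2 * A_poly k = M_prod k $ 1 $ 1 + M_prod k $ 2 $ 2"
proof -
  obtain a b c d where q: "(THE q. is_pauli_expansion (M_prod k) q) = (a, b, c, d)"
    by (metis prod_cases4)
  have "is_pauli_expansion (M_prod k) (a, b, c, d)"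
    using theI'[OF ex1_pauli_expansion[of "M_prod k"]] by (simp add: q)
  then show ?thesis
    by (simp add: is_pauli_expansion_iff A_poly_def q algebra_simps)
qed

text \<open>
  The specialised product is the \<open>2k\<close>-th power of \<open>[[x, 1], [1, 0]]\<close>, so its entries
  \<open>a, b, c, d\<close> are \<open>F\<^bsub>2k+1\<^esub>, F\<^bsub>2k\<^esub>, F\<^bsub>2k\<^esub>, F\<^bsub>2k-1\<^esub>\<close> for the Fibonacci polynomials \<open>F\<close>. The last two
  conjuncts are \<open>L\<^bsub>n\<^esub> = F\<^bsub>n+1\<^esub> + F\<^bsub>n-1\<^esub>\<close> for \<open>n = 2k\<close> and \<open>n = 2k + 1\<close>.
\<close>
lemma subst_M_prod_lucas:
  fixes x :: "complex poly"
  defines "x \<equiv> [:0, 1:]"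
  defines "e \<equiv> \<lambda>k i j. subst (\<lambda>_. x) (M_prod k $ i $ j)"
  shows "e k 1 2 = e k 2 1 \<and> e k 1 1 = x * e k 1 2 + e k 2 2 \<and>
    lucas_poly (2 * k) = e k 1 1 + e k 2 2 \<and>
    lucas_poly (Suc (2 * k)) = x * e k 1 1 + 2 * e k 1 2"
proof (induction k)
  case 0
  show ?case
    by (simp add: e_def mat_def subst_zero subst_one x_def)
next
  case (Suc k)
  have step: "e (Suc k) i 1 = e k i 1 * (1 + x * x) + e k i 2 * x"
    "e (Suc k) i 2 = e k i 1 * x + e k i 2" for i
    by (simp_all add: e_def M_def matrix_matrix_mult_def sum_2 subst_add subst_mult subst_one
        subst_mvar)
  have lucas_step: "lucas_poly (Suc (Suc n)) = x * lucas_poly (Suc n) + lucas_poly n" for n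
    by (simp add: x_def)
  have two: "2 * Suc k = Suc (Suc (2 * k))"
    by simp
  \<comment> \<open>One more factor advances the Lucas index by two. The even conjunct follows from
    the two Lucas conjuncts; the odd one also needs
    \<open>e k 1 1 = x * e k 1 2 + e k 2 2\<close>.\<close>
  from Suc show ?case
    unfolding two lucas_step step by (auto simp: algebra_simps)
qed

theorem theorem2p1:
  fixes k :: nat
  assumes "k \<ge> 1"
  shows "2 * subst (\<lambda>_. [:0, 1:]) (A_poly k) = lucas_poly (2 * k)"
proof -
  have "2 * subst (\<lambda>_. [:0, 1:]) (A_poly k) = subst (\<lambda>_. [:0, 1:]) (2 * A_poly k)"
    by (simp only: mult_2 subst_add)
  also have "\<dots> = lucas_poly (2 * k)"
    by (simp only: double_A_poly subst_add subst_M_prod_lucas)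
  finally show ?thesis .
qed

end
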